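(* Suppose that each $f_i:\mathbb{R}^{n\times r}\to\mathbb{R}$ ($i=1,\dots,m$) is $\tau$-weakly convex on $\mathbb{R}^{n\times r}$ for some $\tau\ge0$, and let $f=\frac1m\sum_{i=1}^m f_i$. Let $\mathcal{U}$ be any bounded open convex set that contains $\mathrm{St}(n,r)$ and let $L>0$ be an upper bound on the Lipschitz constants of $f_1,\dots,f_m$ on $\mathcal{U}$. Suppose further that $\mathcal{X}\subseteq\mathrm{St}(n,r)$ is a set of weak sharp minima for $f$ with parameter $\alpha>0$ over the set $\mathcal{B}=\{X\in\mathbb{R}^{n\times r}:\mathrm{dist}(X,\mathcal{X})<\rho\}\cap\mathrm{St}(n,r)$, where $\rho>0$. Let $\{X_k\}$ be the sequence generated by the Riemannian incremental subgradient method for minimizing $f$ over $\mathrm{St}(n,r)$, in which the initial point $X_0\in\mathrm{St}(n,r)$ satisfies $\mathrm{dist}(X_0,\mathcal{X})<\min\{\frac{\alpha}{L+\tau},\rho\}$ and the stepsizes satisfy $\gamma_k=\beta^k\gamma_0$, $k=0,1,\dots$, where $$0<\gamma_0<\min\left\{\frac{2me_0(\alpha-(L+\tau)e_0)}{d(m)L^2},\ \frac{e_0}{2m(\alpha-(L+\tau)e_0)}\right\},$$ $$\beta\in[\beta_{\min},1)\quad\text{with}\quad \beta_{\min}:=\sqrt{1+2m\left(L+\tau-\frac{\alpha}{e_0}\right)\gamma_0+\frac{d(m)L^2}{e_0^2}\gamma_0^2},$$ $$d(m)=\frac53m^2-m+\frac13,\qquad e_0=\min\left\{\max\left\{\mathrm{dist}(X_0,\mathcal{X}),\frac{\alpha}{2(L+\tau)}\right\},\rho\right\}.$$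 Then $$\mathrm{dist}(X_k,\mathcal{X})\le\beta^k\cdot e_0,\qquad\forall\,k\ge0.$$
   Context: $\mathrm{St}(n,r)=\{X\in\mathbb{R}^{n\times r}: X^\top X=I_r\}$, with tangent space $T_X\mathrm{St}=\{\xi:\xi^\top X+X^\top\xi=0\}$; $\langle A,B\rangle=\mathrm{trace}(A^\top B)$, $\|A\|_F=\sqrt{\langle A,A\rangle}$, $\mathrm{dist}(X,\mathcal{X})=\inf_{Y\in\mathcal{X}}\|Y-X\|_F$. A function $h$ is $\tau$-weakly convex if $g:=h+\frac\tau2\|\cdot\|_F^2$ is convex; its Euclidean subdifferential is $\partial h(X)=\partial g(X)-\tau X$ ($\partial g$ the convex subdifferential), and its Riemannian subdifferential at $X\in\mathrm{St}(n,r)$ is $\partial_{\mathcal R}h(X)=\mathcal{P}_{T_X\mathrm{St}}(\partial h(X))$, with $\mathcal{P}_{T_X\mathrm{St}}(B)=B-\frac12X(B^\top X+X^\top B)$. Weak sharp minima: a (nonempty) set $\mathcal{X}\subseteq\mathrm{St}(n,r)$ is a set of weak sharp minima for $h:\mathbb{R}^{n\times r}\to\mathbb{R}$ with parameter $\alpha>0$ if there is $\rho>0$ such that for every $X\in\mathcal{B}:=\{X\in\mathbb{R}^{n\times r}:\mathrm{dist}(X,\mathcal{X})<\rho\}\cap\mathrm{St}(n,r)$ and every $Y\in\mathcal{X}$ one has $h(X)-h(Y)\ge\alpha\,\mathrm{dist}(X,\mathcal{X})$. The retraction is the polar one: $\mathrm{Retr}_X(\xi)=(X+\xi)(I_r+\xi^\top\xi)^{-1/2}$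 for $X\in\mathrm{St}(n,r)$, $\xi\in T_X\mathrm{St}$. Riemannian incremental subgradient method with stepsizes $\gamma_k>0$: given $X_k\in\mathrm{St}(n,r)$, set $X_{k,0}=X_k$; for $i=1,\dots,m$ set $X_{k,i}=\mathrm{Retr}_{X_{k,i-1}}(-\gamma_k\widetilde\nabla_{\mathcal R}f_i(X_{k,i-1}))$, where $\widetilde\nabla_{\mathcal R}f_i(X_{k,i-1})$ is an arbitrary element of $\partial_{\mathcal R}f_i(X_{k,i-1})$; set $X_{k+1}=X_{k,m}$. *)

theory Defs
  imports "HOL-Analysis.Analysis"
begin

text \<open>
  An \<open>n \<times> r\<close> real matrix is an element of \<^typ>\<open>real^'r^'n\<close>. The library's inner product,
  norm and distance on this type are the trace inner product and the Frobenius norm and distance: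
\<close>

lemma inner_eq_trace:
  fixes A B :: "real^'r^'n"
  shows "A \<bullet> B = trace (transpose A ** B)"
  unfolding inner_vec_def trace_def matrix_matrix_mult_def transpose_def
  by (simp, rule sum.swap)

lemma norm_eq_frobenius:
  fixes A :: "real^'r^'n"
  shows "norm A = sqrt (trace (transpose A ** A))"
  by (simp add: norm_eq_sqrt_inner inner_eq_trace)

definition Stiefel :: "(real^'r^'n) set" where
  "Stiefel = {X. transpose X ** X = mat 1}"

definition tangent_space :: "real^'r^'n \<Rightarrow> (real^'r^'n) set" where
  "tangent_space X = {\<xi>. transpose \<xi> ** X + transpose X ** \<xi> = 0}"

definition tangent_proj :: "real^'r^'n \<Rightarrow> real^'r^'n \<Rightarrow> real^'r^'n" where
  "tangent_proj X B = B - (1/2) *\<^sub>R (X ** (transpose B ** X + transpose X ** B))"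

lemma tangent_proj_in_tangent_space:
  fixes X B :: "real^'r^'n"
  assumes "X \<in> Stiefel"
  shows "tangent_proj X B \<in> tangent_space X"
proof -
  let ?M = "transpose B ** X + transpose X ** B"
  have XX: "transpose X ** X = mat 1"
    using assms by (simp add: Stiefel_def)
  have tadd: "transpose (P + Q) = transpose P + transpose Q" for P Q :: "real^'k^'l"
    by (simp add: transpose_def vec_eq_iff)
  have tdiff: "transpose (P - Q) = transpose P - transpose Q" for P Q :: "real^'k^'l"
    by (simp add: transpose_def vec_eq_iff)
  have ml: "(P - Q) ** R = P ** R - Q ** R" for P Q :: "real^'n^'r" and R :: "real^'r^'n"
    by (simp add: matrix_matrix_mult_def vec_eq_iff left_diff_distrib sum_subtractf)
  have mr: "P ** (Q - R) = P ** Q - P ** R" for P :: "real^'n^'r" and Q R :: "real^'r^'n"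
    by (simp add: matrix_matrix_mult_def vec_eq_iff right_diff_distrib sum_subtractf)
  have sl: "(c *\<^sub>R P) ** R = c *\<^sub>R (P ** R)" for c and P :: "real^'n^'r" and R :: "real^'r^'n"
    by (simp add: matrix_matrix_mult_def vec_eq_iff sum_distrib_left mult.assoc)
  have sr: "P ** (c *\<^sub>R R) = c *\<^sub>R (P ** R)" for c and P :: "real^'n^'r" and R :: "real^'r^'n"
    by (simp add: matrix_matrix_mult_def vec_eq_iff sum_distrib_left mult.left_commute)
  have ts: "transpose (c *\<^sub>R P) = c *\<^sub>R transpose P" for c and P :: "real^'r^'n"
    by (simp add: transpose_def vec_eq_iff)
  have tM: "transpose ?M = ?M"
    by (simp add: tadd matrix_transpose_mul add.commute)
  have l: "transpose (X ** ?M) ** X = ?M"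
    by (simp add: matrix_transpose_mul tM matrix_mul_assoc [symmetric] XX)
  have r: "transpose X ** (X ** ?M) = ?M"
    by (simp add: matrix_mul_assoc XX)
  have "transpose (tangent_proj X B) ** X + transpose X ** tangent_proj X B
      = ?M - (1/2) *\<^sub>R ?M - (1/2) *\<^sub>R ?M"
    unfolding tangent_proj_def
    by (simp only: tdiff ml mr sl sr ts l r) (simp add: algebra_simps)
  also have "\<dots> = 0"
    by (simp add: diff_diff_eq scaleR_left_distrib [symmetric] del: scaleR_right_distrib)
  finally show ?thesis
    by (simp add: tangent_space_def)
qed

definition weakly_convex :: "real \<Rightarrow> ('a::real_inner \<Rightarrow> real) \<Rightarrow> bool" where
  "weakly_convex \<tau> h \<longleftrightarrow> convex_on UNIV (\<lambda>X. h X + \<tau> / 2 * (norm X)\<^sup>2)"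

definition convex_subdiff :: "('a::real_inner \<Rightarrow> real) \<Rightarrow> 'a \<Rightarrow> 'a set" where
  "convex_subdiff g X = {G. \<forall>Y. g Y \<ge> g X + G \<bullet> (Y - X)}"

text \<open>
  The subdifferentials of a \<open>\<tau>\<close>-weakly convex function carry \<open>\<tau>\<close> as an explicit argument; they do
  not depend on which admissible \<open>\<tau>\<close> is chosen.
\<close>

definition subdiff :: "real \<Rightarrow> ('a::real_inner \<Rightarrow> real) \<Rightarrow> 'a \<Rightarrow> 'a set" where
  "subdiff \<tau> h X =
     (\<lambda>G. G - \<tau> *\<^sub>R X) ` convex_subdiff (\<lambda>Y. h Y + \<tau> / 2 * (norm Y)\<^sup>2) X"

definition riem_subdiff :: "real \<Rightarrow> (real^'r^'n \<Rightarrow> real) \<Rightarrow> real^'r^'n \<Rightarrow> (real^'r^'n) set" where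
  "riem_subdiff \<tau> h X = tangent_proj X ` subdiff \<tau> h X"

definition pos_def_matrix :: "real^'r^'r \<Rightarrow> bool" where
  "pos_def_matrix A \<longleftrightarrow> transpose A = A \<and> (\<forall>v. v \<noteq> 0 \<longrightarrow> 0 < v \<bullet> (A *v v))"

text \<open>
  Meaningful only for positive definite \<open>A\<close>: \<open>A\<^sup>1\<^sup>/\<^sup>2\<close> is the unique positive definite square root, and
  \<open>A\<^sup>-\<^sup>1\<^sup>/\<^sup>2\<close> is its inverse.
\<close>

definition matrix_sqrt :: "real^'r^'r \<Rightarrow> real^'r^'r" where
  "matrix_sqrt A = (THE S. pos_def_matrix S \<and> S ** S = A)"

definition matrix_inv_sqrt :: "real^'r^'r \<Rightarrow> real^'r^'r" where
  "matrix_inv_sqrt A = matrix_inv (matrix_sqrt A)"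

definition polar_retr :: "real^'r^'n \<Rightarrow> real^'r^'n \<Rightarrow> real^'r^'n" where
  "polar_retr X \<xi> = (X + \<xi>) ** matrix_inv_sqrt (mat 1 + transpose \<xi> ** \<xi>)"

text \<open>
  Here \<open>infdist X \<X>\<close> is the infimum of \<open>dist X Y\<close> over \<open>Y \<in> \<X>\<close>, as \<open>\<X>\<close> is nonempty.
\<close>

definition weak_sharp_minima ::
    "(real^'r^'n \<Rightarrow> real) \<Rightarrow> (real^'r^'n) set \<Rightarrow> real \<Rightarrow> real \<Rightarrow> bool" where
  "weak_sharp_minima h \<X> \<alpha> \<rho> \<longleftrightarrow>
     \<X> \<noteq> {} \<and> \<X> \<subseteq> Stiefel \<and> \<alpha> > 0 \<and> \<rho> > 0 \<and>
     (\<forall>X \<in> {X. infdist X \<X> < \<rho>} \<inter> Stiefel. \<forall>Y \<in> \<X>. h X - h Y \<ge> \<alpha> * infdist X \<X>)"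

text \<open>
  \<open>X\<close> is a sequence generated by the method for some choice of the Riemannian subgradients;
  \<open>Z k i\<close> is the inner iterate \<open>X\<^sub>k\<^sub>,\<^sub>i\<close>, and the component functions are \<open>f 1, \<dots>, f m\<close>.
\<close>

definition riem_incremental_subgrad ::
    "real \<Rightarrow> nat \<Rightarrow> (nat \<Rightarrow> real^'r^'n \<Rightarrow> real) \<Rightarrow> (nat \<Rightarrow> real) \<Rightarrow> (nat \<Rightarrow> real^'r^'n) \<Rightarrow> bool" where
  "riem_incremental_subgrad \<tau> m f \<gamma> X \<longleftrightarrow>
     X 0 \<in> Stiefel \<and> (\<forall>k. \<gamma> k > 0) \<and>
     (\<exists>Z. \<forall>k. Z k 0 = X k \<and>
        (\<forall>i\<in>{1..m}. \<exists>G \<in> riem_subdiff \<tau> (f i) (Z k (i - 1)).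
            Z k i = polar_retr (Z k (i - 1)) (- \<gamma> k *\<^sub>R G)) \<and>
        X (Suc k) = Z k m)"

end

theory Submission
  imports Defs
begin

text \<open>
  The argument follows the squared distance to the solution set through one cycle of the method.

  Three geometric facts make the Stiefel manifold behave almost like a convex set in Euclidean space.
  A tangential subgradient satisfies the subgradient inequality of an \<open>(L + \<tau>)\<close>-weakly convex function
  (\<open>riemannian_subgradient_inequality\<close>), because the discarded normal part meets the chord \<open>Y - X\<close> only
  to second order (\<open>normal_component_bound\<close>). Subgradients are bounded by \<open>L\<close>. Finally, the
  polar retraction does not increase the distance to points of the manifold (\<open>polar_retr_closer\<close>).
  Hence an inner step obeys the usual inequality for a Euclidean subgradient step. The inverse
  square root in the retraction is identified through the polar decomposition
  (\<open>polar_decomposition_exists\<close>) and the uniqueness of positive definite roots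
  (\<open>pos_def_sqrt_unique\<close>).

  Adding the inner steps and controlling the drift of the inner iterates
  (\<open>incremental_cycle_estimate\<close>) leads with sharpness to
  \<open>\<delta>'\<^sup>2 \<le> (1 + 2 m \<gamma> (L + \<tau>)) \<delta>\<^sup>2 - 2 m \<gamma> \<alpha> \<delta> + d L\<^sup>2 \<gamma>\<^sup>2\<close> for the distances \<open>\<delta>\<close> and \<open>\<delta>'\<close> before and
  after a cycle (\<open>riem_incremental_distance_recursion\<close>). Below the critical radius \<open>\<alpha> / (L + \<tau>)\<close> the
  sharpness term wins over the curvature term. If \<open>\<gamma>\<close> is proportional to the current bound
  \<open>\<beta> ^ k e\<^sub>0\<close> on \<open>\<delta>\<close>, then the right-hand side is at most \<open>\<beta>\<^sub>m\<^sub>i\<^sub>n\<^sup>2 (\<beta> ^ k e\<^sub>0)\<^sup>2\<close>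
  (\<open>geometric_contraction\<close>), and the bound contracts geometrically.
\<close>

section \<open>The trace inner product and matrix multiplication\<close>

lemma bounded_bilinear_matrix_mul:
  "bounded_bilinear ((**) :: real^'b^'a \<Rightarrow> real^'c^'b \<Rightarrow> real^'c^'a)"
proof -
  have "bilinear ((**) :: real^'b^'a \<Rightarrow> real^'c^'b \<Rightarrow> real^'c^'a)"
    unfolding bilinear_def
    by (auto intro!: linearI simp: matrix_add_ldistrib matrix_scalar_ac scalar_matrix_assoc)
       (simp add: matrix_matrix_mult_def vec_eq_iff distrib_right sum.distrib)
  then show ?thesis
    by (simp add: bilinear_conv_bounded_bilinear)
qed

lemmas matrix_mul_linear =
  bounded_bilinear.add_left [OF bounded_bilinear_matrix_mul]
  bounded_bilinear.add_right [OF bounded_bilinear_matrix_mul]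
  bounded_bilinear.diff_left [OF bounded_bilinear_matrix_mul]
  bounded_bilinear.diff_right [OF bounded_bilinear_matrix_mul]
  bounded_bilinear.scaleR_left [OF bounded_bilinear_matrix_mul]
  bounded_bilinear.scaleR_right [OF bounded_bilinear_matrix_mul]

lemma bounded_linear_transpose:
  "bounded_linear (transpose :: real^'b^'a \<Rightarrow> real^'a^'b)"
  by (auto intro!: linearI simp: transpose_def vec_eq_iff simp flip: linear_conv_bounded_linear)

lemmas transpose_linear =
  linear_add [OF bounded_linear.linear [OF bounded_linear_transpose]]
  linear_diff [OF bounded_linear.linear [OF bounded_linear_transpose]]
  linear_scale [OF bounded_linear.linear [OF bounded_linear_transpose]]

lemma inner_transpose:
  fixes A B :: "real^'b^'a"
  shows "transpose A \<bullet> transpose B = A \<bullet> B"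
  unfolding inner_vec_def transpose_def by (simp, rule sum.swap)

lemma inner_matrix_mul_left:
  fixes A :: "real^'b^'a" and B :: "real^'c^'b"
  shows "(A ** B) \<bullet> C = B \<bullet> (transpose A ** C)"
  by (simp add: inner_eq_trace matrix_transpose_mul matrix_mul_assoc)

lemma inner_matrix_mul_right:
  fixes A :: "real^'b^'a" and B :: "real^'c^'b"
  shows "(A ** B) \<bullet> C = A \<bullet> (C ** transpose B)"
proof -
  have "(A ** B) \<bullet> C = (transpose B ** transpose A) \<bullet> transpose C"
    by (metis inner_transpose matrix_transpose_mul)
  also have "\<dots> = transpose A \<bullet> transpose (C ** transpose B)"
    by (simp add: inner_matrix_mul_left matrix_transpose_mul)
  finally show ?thesis
    by (simp add: inner_transpose)
qed

text \<open>
  A Frobenius product with a square matrix in the middle splits into one quadratic form per row.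
  In this way positivity of \<open>M\<close> as a form on vectors yields inequalities between matrices.
\<close>

lemma inner_matrix_mul_rows:
  fixes A B :: "real^'b^'a" and M :: "real^'b^'b"
  shows "(A ** M) \<bullet> B = (\<Sum>i\<in>UNIV. A $ i \<bullet> (M *v B $ i))"
proof -
  have "(A ** M) $ i = A $ i v* M" for i
    by (simp add: matrix_matrix_mult_def vector_matrix_mult_def vec_eq_iff)
  then show ?thesis
    by (simp add: inner_vec_def [of "A ** M"] dot_lmul_matrix)
qed

lemma norm_matrix_vector_le:
  fixes G :: "real^'b^'a"
  shows "norm (G *v x) \<le> norm G * norm x"
proof (rule power2_le_imp_le)
  have "(norm (G *v x))\<^sup>2 = (\<Sum>i\<in>UNIV. (G $ i \<bullet> x)\<^sup>2)"
    unfolding power2_norm_eq_inner inner_vec_def [of "G *v x"] matrix_vector_mul_component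
    by (simp add: power2_eq_square)
  also have "\<dots> \<le> (\<Sum>i\<in>UNIV. (G $ i \<bullet> G $ i) * (x \<bullet> x))"
    by (intro sum_mono Cauchy_Schwarz_ineq)
  also have "\<dots> = (norm G)\<^sup>2 * (norm x)\<^sup>2"
    by (simp add: power2_norm_eq_inner inner_vec_def [of G] sum_distrib_right)
  finally show "(norm (G *v x))\<^sup>2 \<le> (norm G * norm x)\<^sup>2"
    by (simp add: power_mult_distrib)
qed simp

lemma symmetric_inner:
  assumes "transpose S = (S :: real^'b^'b)"
  shows "x \<bullet> (S *v y) = (S *v x) \<bullet> y"
  by (metis assms dot_lmul_matrix transpose_matrix_vector)

section \<open>Polar decomposition and square roots of matrices\<close>

definition dyad :: "real^'b \<Rightarrow> real^'b \<Rightarrow> real^'b^'b" where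
  "dyad u v = (\<chi> i j. u $ i * v $ j)"

lemma inner_dyad: "M \<bullet> dyad u v = u \<bullet> (M *v v)"
  by (simp add: inner_vec_def dyad_def matrix_vector_mult_def sum_distrib_left mult_ac)

lemma dyad_mul_dyad: "dyad a b ** dyad u v = (b \<bullet> u) *\<^sub>R dyad a v"
  by (simp add: vec_eq_iff dyad_def matrix_matrix_mult_def inner_vec_def sum_distrib_right
      sum_distrib_left mult_ac)

lemma transpose_dyad: "transpose (dyad u v) = dyad v u"
  by (simp add: dyad_def transpose_def vec_eq_iff mult.commute)

text \<open>
  For \<open>u = 0\<close> the division by zero makes this the identity matrix, which is orthogonal as well.
\<close>

definition householder :: "real^'b \<Rightarrow> real^'b^'b" where
  "householder u = mat 1 - (2 / (u \<bullet> u)) *\<^sub>R dyad u u"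

lemma householder_orthogonal: "orthogonal_matrix (householder u)"
proof (cases "u = 0")
  case True
  then show ?thesis
    by (simp add: householder_def orthogonal_matrix_id)
next
  case False
  define H where "H = (2 / (u \<bullet> u)) *\<^sub>R dyad u u"
  have "H ** H = (2 / (u \<bullet> u) * 2) *\<^sub>R dyad u u"
    using False by (simp add: H_def matrix_mul_linear dyad_mul_dyad)
  also have "\<dots> = H + H"
    by (simp add: H_def flip: scaleR_left_distrib)
  finally have "(mat 1 - H) ** (mat 1 - H) = mat 1"
    by (simp add: matrix_mul_linear)
  moreover have "transpose H = H"
    by (simp add: H_def transpose_linear transpose_dyad)
  ultimately show ?thesis
    by (simp add: orthogonal_matrix householder_def transpose_linear flip: H_def)
qed

text \<open>
  A first-order optimality condition, obtained by testing with explicit orthogonal matrices: one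
  Householder reflection gives nonnegativity of the quadratic form, and the product of the
  reflections in \<open>u\<close> and \<open>u + t w\<close>, a rotation by an angle of order \<open>t\<close> in the plane of \<open>u\<close> and
  \<open>w\<close>, gives symmetry as \<open>t\<close> tends to \<open>0\<close>.
\<close>

lemma maximal_trace_over_orthogonal:
  fixes M :: "real^'b^'b"
  assumes max: "\<And>Q. orthogonal_matrix Q \<Longrightarrow> M \<bullet> Q \<le> M \<bullet> mat 1"
  shows "transpose M = M" and "\<And>v. 0 \<le> v \<bullet> (M *v v)"
proof -
  show nonneg: "0 \<le> v \<bullet> (M *v v)" for v
  proof (cases "v = 0")
    case False
    have "M \<bullet> householder v \<le> M \<bullet> mat 1"
      by (rule max [OF householder_orthogonal])
    moreover have "v \<bullet> v > 0"
      using False by simp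
    ultimately show ?thesis
      by (auto simp: householder_def inner_diff_right inner_dyad zero_le_divide_iff
          simp del: inner_gt_zero_iff)
  qed simp
  have "u \<bullet> (M *v w) \<le> w \<bullet> (M *v u)" if u: "u \<bullet> u = 1" and w: "w \<bullet> w = 1" and uw: "u \<bullet> w = 0"
    for u w
  proof (rule ccontr)
    define a where "a = u \<bullet> (M *v w) - w \<bullet> (M *v u)"
    define b where "b = u \<bullet> (M *v u) + w \<bullet> (M *v w)"
    assume "\<not> ?thesis"
    then have a: "a > 0" by (simp add: a_def)
    have b: "b \<ge> 0" by (simp add: b_def nonneg)
    \<comment> \<open>The gain of the rotation is linear in \<open>t\<close> with slope \<open>a\<close>, up to a term of order \<open>t\<^sup>2\<close>.\<close>
    have ineq: "t * a \<le> t\<^sup>2 * b" for t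
    proof -
      define v where "v = u + t *\<^sub>R w"
      have vv: "v \<bullet> v = 1 + t\<^sup>2"
        using u w uw by (simp add: v_def inner_add_left inner_add_right power2_eq_square
            inner_commute)
      have uv: "u \<bullet> v = 1"
        using u uw by (simp add: v_def inner_add_right)
      have pos: "1 + t\<^sup>2 > 0" by (simp add: add_pos_nonneg)
      have "orthogonal_matrix (householder u ** householder v)"
        by (intro orthogonal_matrix_mul householder_orthogonal)
      from max [OF this] have "M \<bullet> (householder u ** householder v) \<le> M \<bullet> mat 1" .
      moreover define c where "c = 2 / (1 + t\<^sup>2)"
      have "householder u = mat 1 - 2 *\<^sub>R dyad u u" "householder v = mat 1 - c *\<^sub>R dyad v v"
        by (simp_all only: householder_def u vv c_def div_by_1)
      then have "householder u ** householder v
          = mat 1 - 2 *\<^sub>R dyad u u - c *\<^sub>R dyad v v + (2 * c) *\<^sub>R dyad u v"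
        by (simp add: matrix_mul_linear dyad_mul_dyad uv mult.commute scaleR_right_diff_distrib)
      ultimately have "(2 * c) * (u \<bullet> (M *v v)) \<le> 2 * (u \<bullet> (M *v u)) + c * (v \<bullet> (M *v v))"
        by (simp add: inner_diff_right inner_add_right inner_dyad)
      then have "(2 * c) * (u \<bullet> (M *v v)) * (1 + t\<^sup>2)
          \<le> (2 * (u \<bullet> (M *v u)) + c * (v \<bullet> (M *v v))) * (1 + t\<^sup>2)"
        using pos by (intro mult_right_mono) auto
      moreover have "(2 * c) * p * (1 + t\<^sup>2) = 4 * p"
        "(2 * q + c * p) * (1 + t\<^sup>2) = 2 * q * (1 + t\<^sup>2) + 2 * p" for p q
        using pos by (simp_all add: c_def field_simps)
      ultimately have le: "4 * (u \<bullet> (M *v v)) \<le> 2 * (u \<bullet> (M *v u)) * (1 + t\<^sup>2) + 2 * (v \<bullet> (M *v v))"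
        by (simp only:)
      have vv': "u \<bullet> (M *v v) = u \<bullet> (M *v u) + t * (u \<bullet> (M *v w))"
        "v \<bullet> (M *v v) = u \<bullet> (M *v u) + t * (u \<bullet> (M *v w)) + t * (w \<bullet> (M *v u)) + t\<^sup>2 * (w \<bullet> (M *v w))"
        by (simp_all add: v_def matrix_vector_right_distrib matrix_vector_mult_scaleR
            inner_add_left inner_add_right power2_eq_square distrib_left)
      have arith: "t * (q - r) \<le> t\<^sup>2 * (p + s)"
        if "4 * (p + t * q) \<le> 2 * p * (1 + t\<^sup>2) + 2 * (p + t * q + t * r + t\<^sup>2 * s)" for p q r s
        using that by (simp add: algebra_simps)
      show ?thesis
        unfolding a_def b_def by (rule arith) (use le vv' in \<open>simp only:\<close>)
    qed
    define t where "t = a / (b + 1)"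
    have t: "t > 0" "t * (b + 1) = a"
      using a b by (simp_all add: t_def)
    from ineq [of t] t have "a \<le> t * b"
      by (simp add: power2_eq_square mult.assoc)
    with t show False
      by (simp add: distrib_left)
  qed
  note le_swap = this
  have entry: "axis i 1 \<bullet> (M *v axis j 1) = M $ i $ j" for i j
    by (simp add: inner_axis' matrix_vector_mul_component inner_axis)
  have le: "M $ i $ j \<le> M $ j $ i" if "i \<noteq> j" for i j
    using le_swap [of "axis i 1" "axis j 1"] that unfolding entry by (simp add: inner_axis_axis)
  show "transpose M = M"
  proof -
    have "M $ j $ i = M $ i $ j" for i j
      by (cases "i = j") (auto intro: order_antisym le)
    then show ?thesis
      by (simp add: vec_eq_iff transpose_def)
  qed
qed

lemma compact_Stiefel: "compact (Stiefel :: (real^'r^'n) set)"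
proof -
  have "closed {X :: real^'r^'n. transpose X ** X = mat 1}"
    by (intro closed_Collect_eq continuous_intros
        bounded_bilinear.continuous_on [OF bounded_bilinear_matrix_mul]
        bounded_linear.continuous_on [OF bounded_linear_transpose])
  moreover have "norm X = sqrt (trace (mat 1 :: real^'r^'r))" if "X \<in> Stiefel" for X :: "real^'r^'n"
    using that by (simp add: norm_eq_frobenius Stiefel_def)
  ultimately show ?thesis
    unfolding compact_eq_bounded_closed bounded_iff Stiefel_def [symmetric]
    by (auto intro!: exI [of _ "sqrt (trace (mat 1 :: real^'r^'r))"])
qed

text \<open>
  The orthogonal factor is a maximiser \<open>P\<close> of \<open>W \<bullet> P\<close> over the compact Stiefel manifold. Since
  \<open>P Q\<close> and \<open>Q P\<close> stay on the manifold for orthogonal \<open>Q\<close> of the right size, both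
  \<open>S = P\<^sup>T W\<close> and \<open>W P\<^sup>T\<close> maximise the trace against orthogonal matrices, so both are symmetric,
  whence \<open>W = W P\<^sup>T P = P W\<^sup>T P = P S\<close>.
\<close>

lemma polar_decomposition_exists:
  fixes W :: "real^'r^'n"
  assumes "(Stiefel :: (real^'r^'n) set) \<noteq> {}"
  obtains P S where "P \<in> Stiefel" "W = P ** S" "transpose S = S" "\<And>v. 0 \<le> v \<bullet> (S *v v)"
proof -
  obtain P where P: "P \<in> Stiefel" and max: "\<And>R. R \<in> Stiefel \<Longrightarrow> W \<bullet> R \<le> W \<bullet> P"
    using continuous_attains_sup [OF compact_Stiefel assms, of "\<lambda>R. W \<bullet> R"]
      continuous_on_inner [OF continuous_on_const continuous_on_id]
    by blast
  have PP: "transpose P ** P = mat 1"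
    using P by (simp add: Stiefel_def)
  have right: "(transpose P ** W) \<bullet> Q \<le> (transpose P ** W) \<bullet> mat 1" if "orthogonal_matrix Q" for Q
  proof -
    have "transpose (P ** Q) ** (P ** Q) = transpose Q ** (transpose P ** P) ** Q"
      by (simp add: matrix_transpose_mul matrix_mul_assoc)
    with that PP have "P ** Q \<in> Stiefel"
      by (simp add: Stiefel_def orthogonal_matrix)
    from max [OF this] show ?thesis
      by (simp add: inner_matrix_mul_left)
  qed
  have left: "(W ** transpose P) \<bullet> Q \<le> (W ** transpose P) \<bullet> mat 1" if "orthogonal_matrix Q" for Q
  proof -
    have "transpose (Q ** P) ** (Q ** P) = transpose P ** (transpose Q ** Q) ** P"
      by (simp add: matrix_transpose_mul matrix_mul_assoc)
    with that PP have "Q ** P \<in> Stiefel"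
      by (simp add: Stiefel_def orthogonal_matrix)
    from max [OF this] show ?thesis
      by (simp add: inner_matrix_mul_right)
  qed
  note S = maximal_trace_over_orthogonal [OF right]
  have "W = (W ** transpose P) ** P"
    by (simp add: PP flip: matrix_mul_assoc)
  also have "W ** transpose P = P ** transpose W"
    using maximal_trace_over_orthogonal(1) [OF left] by (simp add: matrix_transpose_mul)
  also have "P ** transpose W ** P = P ** (transpose P ** W)"
    using S(1) by (simp add: matrix_transpose_mul flip: matrix_mul_assoc)
  finally show ?thesis
    using that [OF P _ S] by blast
qed

text \<open>
  With \<open>D = S - T\<close> and \<open>K = S + T\<close>, equality of the squares says \<open>D K + K D = 0\<close>. Pairing this with
  \<open>D\<close> makes the sum over the rows \<open>x\<close> of \<open>D\<close> of the positive numbers \<open>x\<^sup>T K x\<close> vanish.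
\<close>

lemma pos_def_sqrt_unique:
  fixes S T :: "real^'r^'r"
  assumes S: "pos_def_matrix S" and T: "pos_def_matrix T" and eq: "S ** S = T ** T"
  shows "S = T"
proof -
  define D where "D = S - T"
  define K where "K = S + T"
  have K: "0 < v \<bullet> (K *v v)" if "v \<noteq> 0" for v
    using that S T by (simp add: K_def pos_def_matrix_def matrix_vector_mult_add_rdistrib
        inner_add_right add_pos_pos)
  have tD: "transpose D = D" and tK: "transpose K = K"
    using S T by (simp_all add: D_def K_def pos_def_matrix_def transpose_linear)
  have "D ** K + K ** D = 0"
    using eq by (simp add: D_def K_def matrix_mul_linear)
  then have "D ** K = - (K ** D)"
    by (simp add: eq_neg_iff_add_eq_0)
  then have "(D ** K) \<bullet> D = - ((K ** D) \<bullet> D)"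
    by simp
  also have "(K ** D) \<bullet> D = (D ** K) \<bullet> D"
    by (metis inner_transpose matrix_transpose_mul tD tK)
  finally have "(\<Sum>i\<in>UNIV. D $ i \<bullet> (K *v D $ i)) = 0"
    by (simp add: inner_matrix_mul_rows)
  moreover have "0 \<le> D $ i \<bullet> (K *v D $ i)" for i
    using K [of "D $ i"] by (cases "D $ i = 0") auto
  ultimately have "D $ i \<bullet> (K *v D $ i) = 0" for i
    by (simp add: sum_nonneg_eq_0_iff)
  then have "D $ i = 0" for i
    using K [of "D $ i"] by force
  then show ?thesis
    by (simp add: D_def vec_eq_iff)
qed

text \<open>
  Write \<open>v = S u\<close>, so that \<open>\<bar>u\<bar> \<le> \<bar>v\<bar>\<close>, and expand \<open>0 \<le> (v - u)\<^sup>T S (v - u)\<close>. In terms of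
  eigenvalues: if none is negative and all have modulus at least \<open>1\<close>, then all are at least \<open>1\<close>.
\<close>

lemma psd_expansive_ge_identity:
  fixes S :: "real^'r^'r"
  assumes sym: "transpose S = S" and psd: "\<And>v. 0 \<le> v \<bullet> (S *v v)"
    and expand: "\<And>v. norm v \<le> norm (S *v v)"
  shows "v \<bullet> v \<le> v \<bullet> (S *v v)" and "invertible S"
proof -
  have "\<forall>x. S *v x = 0 \<longrightarrow> x = 0"
    using expand by (metis norm_le_zero_iff norm_zero)
  then show "invertible S"
    by (simp add: invertible_left_inverse matrix_left_invertible_ker)
  then obtain S' where "S ** S' = mat 1"
    by (auto simp: invertible_right_inverse)
  then obtain u where u: "S *v u = v"
    by (metis matrix_vector_mul_assoc matrix_vector_mul_lid)
  have "0 \<le> (v - u) \<bullet> (S *v (v - u))"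
    by (rule psd)
  also have "\<dots> = v \<bullet> (S *v v) - 2 * (v \<bullet> v) + u \<bullet> v"
    using symmetric_inner [OF sym, of u v]
    by (simp add: matrix_vector_mult_diff_distrib inner_diff_left inner_diff_right u)
  also have "u \<bullet> v \<le> norm u * norm v"
    by (rule norm_cauchy_schwarz)
  also have "\<dots> \<le> norm v * norm v"
    using expand [of u] u by (intro mult_right_mono) auto
  also have "\<dots> = v \<bullet> v"
    by (simp add: power2_norm_eq_inner flip: power2_eq_square)
  finally show "v \<bullet> v \<le> v \<bullet> (S *v v)"
    by simp
qed

section \<open>The polar retraction\<close>

text \<open>
  For a tangent vector the Gram matrix of \<open>X + \<xi>\<close> is \<open>I + \<xi>\<^sup>T \<xi>\<close>, so the symmetric factor of the
  polar decomposition of \<open>X + \<xi>\<close> is its square root, and the retraction is the orthogonal factor.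
  The symmetric factor dominates the identity because \<open>I + \<xi>\<^sup>T \<xi>\<close> does.
\<close>

lemma polar_retr_decomposition:
  fixes X \<xi> :: "real^'r^'n"
  assumes X: "X \<in> Stiefel" and \<xi>: "\<xi> \<in> tangent_space X"
  shows "polar_retr X \<xi> \<in> Stiefel"
    and "\<exists>S. X + \<xi> = polar_retr X \<xi> ** S \<and> transpose S = S \<and> (\<forall>v. v \<bullet> v \<le> v \<bullet> (S *v v))"
proof -
  let ?A = "mat 1 + transpose \<xi> ** \<xi>"
  obtain P S where P: "P \<in> Stiefel" and W: "X + \<xi> = P ** S" and sym: "transpose S = S"
    and psd: "\<And>v. 0 \<le> v \<bullet> (S *v v)"
    using polar_decomposition_exists [of "X + \<xi>"] X by blast
  have "S ** S = S ** (transpose P ** P) ** S"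
    using P by (simp add: Stiefel_def)
  also have "\<dots> = transpose (X + \<xi>) ** (X + \<xi>)"
    by (simp add: W matrix_transpose_mul sym matrix_mul_assoc)
  also have "\<dots> = ?A"
    using X \<xi> by (simp add: Stiefel_def tangent_space_def transpose_linear matrix_mul_linear
        algebra_simps)
  finally have SS: "S ** S = ?A" .
  have expand: "norm v \<le> norm (S *v v)" for v
  proof -
    have "(S *v v) \<bullet> (S *v v) = v \<bullet> (?A *v v)"
      by (metis SS symmetric_inner [OF sym] matrix_vector_mul_assoc)
    also have "\<dots> = v \<bullet> v + (\<xi> *v v) \<bullet> (\<xi> *v v)"
      by (simp add: matrix_vector_mult_add_rdistrib inner_add_right dot_lmul_matrix
          flip: matrix_vector_mul_assoc) (metis dot_lmul_matrix inner_commute)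
    finally show ?thesis
      by (simp add: norm_eq_sqrt_inner)
  qed
  note S = psd_expansive_ge_identity [OF sym psd expand]
  have pd: "pos_def_matrix S"
    unfolding pos_def_matrix_def
    using S(1) sym by (metis inner_gt_zero_iff order_less_le_trans)
  have "matrix_sqrt ?A = S"
    unfolding matrix_sqrt_def
  proof (rule the_equality)
    fix T
    assume "pos_def_matrix T \<and> T ** T = ?A"
    then show "T = S"
      using pos_def_sqrt_unique [of T S] pd SS by simp
  qed (use pd SS in simp)
  moreover have "S ** matrix_inv S = mat 1"
    using S(2) unfolding invertible_def matrix_inv_def by (metis (mono_tags, lifting) someI_ex)
  ultimately have "polar_retr X \<xi> = P"
    unfolding polar_retr_def matrix_inv_sqrt_def W by (simp flip: matrix_mul_assoc)
  then show "polar_retr X \<xi> \<in> Stiefel"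
    and "\<exists>S. X + \<xi> = polar_retr X \<xi> ** S \<and> transpose S = S \<and> (\<forall>v. v \<bullet> v \<le> v \<bullet> (S *v v))"
    using P W sym S(1) by auto
qed

text \<open>
  Retracting brings the point \<open>X + \<xi>\<close> no farther from any \<open>Y\<close> on the manifold, although the
  manifold is not convex. With \<open>X + \<xi> = P S\<close>, \<open>E = S - I\<close> and \<open>D = P - Y\<close>, orthonormality of the
  columns of \<open>P\<close> and \<open>Y\<close> gives
  \<open>\<bar>X + \<xi> - Y\<bar>\<^sup>2 - \<bar>P - Y\<bar>\<^sup>2 = \<bar>E\<bar>\<^sup>2 + (D E) \<bullet> D\<close>, and \<open>E\<close> is positive semidefinite.
\<close>

lemma polar_retr_closer:
  fixes X \<xi> Y :: "real^'r^'n"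
  assumes X: "X \<in> Stiefel" and \<xi>: "\<xi> \<in> tangent_space X" and Y: "Y \<in> Stiefel"
  shows "norm (polar_retr X \<xi> - Y) \<le> norm (X + \<xi> - Y)"
proof -
  have P: "polar_retr X \<xi> \<in> Stiefel"
    by (rule polar_retr_decomposition [OF X \<xi>])
  obtain S where W: "X + \<xi> = polar_retr X \<xi> ** S"
    and sym: "transpose S = S" and ge: "\<And>v. v \<bullet> v \<le> v \<bullet> (S *v v)"
    using polar_retr_decomposition(2) [OF X \<xi>] by blast
  define P where "P = polar_retr X \<xi>"
  define D where "D = P - Y"
  define E where "E = S - mat 1"
  have tP: "transpose P ** P = mat 1" and tY: "transpose Y ** Y = mat 1"
    using P Y by (simp_all add: P_def Stiefel_def)
  have W': "X + \<xi> - Y = P ** E + D"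
    by (simp add: W E_def D_def P_def matrix_mul_linear)
  have "(P ** E) \<bullet> (P ** E) = E \<bullet> E"
    by (simp add: inner_matrix_mul_left matrix_mul_assoc tP)
  moreover have "2 * ((P ** E) \<bullet> D) = (D ** E) \<bullet> D"
  proof -
    have tE: "transpose E = E"
      by (simp add: E_def transpose_linear sym)
    have PP: "(P ** E) \<bullet> P = E \<bullet> mat 1" and YY: "(Y ** E) \<bullet> Y = E \<bullet> mat 1"
      by (simp_all add: inner_matrix_mul_left tP tY)
    have "(P ** E) \<bullet> Y = (Y ** E) \<bullet> P"
      using inner_matrix_mul_right [of P E Y] by (simp add: tE inner_commute)
    with PP YY show ?thesis
      by (simp add: D_def matrix_mul_linear inner_diff_left inner_diff_right)
  qed
  moreover have "(D ** E) \<bullet> D \<ge> 0"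
    unfolding inner_matrix_mul_rows E_def
    using ge by (intro sum_nonneg) (simp add: matrix_vector_mult_diff_rdistrib inner_diff_right)
  ultimately have "D \<bullet> D \<le> (P ** E + D) \<bullet> (P ** E + D)"
    by (simp add: inner_add_left inner_add_right inner_commute)
  then have "norm D \<le> norm (X + \<xi> - Y)"
    by (simp add: W' norm_eq_sqrt_inner)
  then show ?thesis
    by (simp add: D_def P_def)
qed

section \<open>Riemannian subgradients\<close>

lemma subdiff_lower_bound:
  assumes "G \<in> subdiff \<tau> h X"
  shows "h X + G \<bullet> (Y - X) - \<tau> / 2 * (norm (Y - X))\<^sup>2 \<le> h Y"
proof -
  have "h X + \<tau> / 2 * (norm X)\<^sup>2 + (G + \<tau> *\<^sub>R X) \<bullet> (Y - X) \<le> h Y + \<tau> / 2 * (norm Y)\<^sup>2"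
    using assms by (auto simp: subdiff_def convex_subdiff_def)
  moreover have "\<tau> / 2 * (norm (Y - X))\<^sup>2
      = \<tau> / 2 * (norm Y)\<^sup>2 - \<tau> / 2 * (norm X)\<^sup>2 - (\<tau> *\<^sub>R X) \<bullet> (Y - X)"
    by (simp add: power2_norm_eq_inner inner_diff_left inner_diff_right inner_commute algebra_simps)
  ultimately show ?thesis
    unfolding inner_add_left by linarith
qed

text \<open>
  Moving a distance \<open>t\<close> along \<open>G\<close> raises \<open>h\<close> at least at the rate \<open>\<bar>G\<bar>\<close> up to an error linear
  in \<open>t\<close>, and at most at the rate \<open>L\<close>; openness of \<open>U\<close> leaves room for small \<open>t\<close>.
\<close>

lemma subdiff_norm_le_lipschitz:
  assumes "open U" "X \<in> U" and lip: "L-lipschitz_on U h" and G: "G \<in> subdiff \<tau> h X"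
  shows "norm G \<le> L"
proof (cases "G = 0")
  case True
  then show ?thesis
    using lipschitz_on_nonneg [OF lip] by simp
next
  case False
  obtain e where e: "e > 0" "ball X e \<subseteq> U"
    using assms(1,2) openE by blast
  have "norm G \<le> L + t * (\<tau> / 2 * norm G)" if t: "0 < t" "t < e / norm G" for t
  proof -
    define Y where "Y = X + t *\<^sub>R G"
    have "Y \<in> U"
      using e(2) t False by (auto simp: Y_def dist_norm field_simps)
    then have "h Y - h X \<le> L * (t * norm G)"
      using lipschitz_onD [OF lip, of Y X] assms(2) t by (simp add: dist_norm Y_def abs_le_iff)
    moreover have "t * (norm G)\<^sup>2 - \<tau> / 2 * (t * norm G)\<^sup>2 \<le> h Y - h X"
      using subdiff_lower_bound [OF G, of Y] t
      by (simp add: Y_def power2_norm_eq_inner power_mult_distrib)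
    ultimately have "(t * norm G) * norm G \<le> (t * norm G) * (L + t * (\<tau> / 2 * norm G))"
      by (simp add: algebra_simps power2_eq_square)
    then show ?thesis
      using t False by simp
  qed
  then have "eventually (\<lambda>t. norm G \<le> L + t * (\<tau> / 2 * norm G)) (at_right 0)"
    using e False by (auto intro!: eventually_at_rightI [of 0 "e / norm G"])
  moreover have "((\<lambda>t. L + t * (\<tau> / 2 * norm G)) \<longlongrightarrow> L + 0 * (\<tau> / 2 * norm G)) (at_right 0)"
    by (intro tendsto_intros)
  ultimately show ?thesis
    by (auto dest: tendsto_lowerbound)
qed

lemma tangent_proj_orthogonal:
  fixes X B \<xi> :: "real^'r^'n"
  assumes "\<xi> \<in> tangent_space X"
  shows "(B - tangent_proj X B) \<bullet> \<xi> = 0"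
proof -
  define M where "M = transpose B ** X + transpose X ** B"
  have "transpose M = M"
    by (simp add: M_def transpose_linear matrix_transpose_mul add.commute)
  then have "M \<bullet> (transpose X ** \<xi>) = M \<bullet> (transpose \<xi> ** X)"
    using inner_transpose [of M "transpose X ** \<xi>"] by (simp add: matrix_transpose_mul)
  moreover have "M \<bullet> (transpose X ** \<xi>) + M \<bullet> (transpose \<xi> ** X) = 0"
    using assms by (simp add: tangent_space_def add.commute flip: inner_add_right)
  ultimately show ?thesis
    by (simp add: tangent_proj_def M_def [symmetric] inner_matrix_mul_left)
qed

lemma norm_tangent_proj_le:
  fixes X B :: "real^'r^'n"
  assumes "X \<in> Stiefel"
  shows "norm (tangent_proj X B) \<le> norm B"
proof (cases "tangent_proj X B = 0")
  case False
  have "(B - tangent_proj X B) \<bullet> tangent_proj X B = 0"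
    by (intro tangent_proj_orthogonal tangent_proj_in_tangent_space assms)
  then have "norm (tangent_proj X B) * norm (tangent_proj X B) = B \<bullet> tangent_proj X B"
    by (simp add: inner_diff_left power2_norm_eq_inner flip: power2_eq_square)
  also have "\<dots> \<le> norm B * norm (tangent_proj X B)"
    by (rule norm_cauchy_schwarz)
  finally show ?thesis
    using False by simp
qed simp

lemma norm_Stiefel_mult_vector:
  fixes X :: "real^'r^'n"
  assumes "X \<in> Stiefel"
  shows "norm (X *v v) = norm v"
proof -
  have "(X *v v) \<bullet> (X *v v) = (v v* transpose X) \<bullet> (X *v v)"
    by simp
  also have "\<dots> = v \<bullet> ((transpose X ** X) *v v)"
    by (simp only: dot_lmul_matrix matrix_vector_mul_assoc)
  finally show ?thesis
    using assms by (simp add: Stiefel_def norm_eq_sqrt_inner)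
qed

text \<open>
  To first order \<open>Y - X\<close> is tangent at \<open>X\<close>, so a normal vector pairs with it only to second order.
  Precisely, the normal part of \<open>B\<close> is \<open>X M / 2\<close> with \<open>M = B\<^sup>T X + X\<^sup>T B\<close> symmetric, the symmetric
  part of \<open>X\<^sup>T (Y - X)\<close> is \<open>- (Y - X)\<^sup>T (Y - X) / 2\<close>, and the resulting product is estimated row by
  row with \<open>\<bar>X v\<bar> = \<bar>v\<bar>\<close>.
\<close>

lemma normal_component_bound:
  fixes X Y B :: "real^'r^'n"
  assumes X: "X \<in> Stiefel" and Y: "Y \<in> Stiefel"
  shows "\<bar>(B - tangent_proj X B) \<bullet> (Y - X)\<bar> \<le> norm B / 2 * (norm (Y - X))\<^sup>2"
proof -
  define D where "D = Y - X"
  define M where "M = transpose B ** X + transpose X ** B"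
  have tM: "transpose M = M"
    by (simp add: M_def transpose_linear matrix_transpose_mul add.commute)
  have tX: "transpose X ** X = mat 1" and tY: "transpose Y ** Y = mat 1"
    using X Y by (simp_all add: Stiefel_def)
  have swap: "M \<bullet> (transpose Y ** X) = M \<bullet> (transpose X ** Y)"
    using inner_transpose [of M "transpose X ** Y"] by (simp add: tM matrix_transpose_mul)
  have expand: "transpose D ** D = mat 1 - transpose Y ** X - (transpose X ** Y - mat 1)"
    by (simp add: D_def transpose_linear matrix_mul_linear tX tY)
  have "M \<bullet> (transpose D ** D) = 2 * (M \<bullet> mat 1) - 2 * (M \<bullet> (transpose X ** Y))"
    unfolding expand inner_diff_right using swap by simp
  moreover have "(X ** M) \<bullet> D = M \<bullet> (transpose X ** Y) - M \<bullet> mat 1"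
    by (simp add: D_def inner_matrix_mul_left matrix_mul_linear tX inner_diff_right)
  moreover have "M \<bullet> (transpose D ** D) = 2 * ((transpose X ** B) \<bullet> (transpose D ** D))"
    using inner_transpose [of "transpose X ** B" "transpose D ** D"]
    by (simp add: M_def inner_add_left matrix_transpose_mul)
  ultimately have "(B - tangent_proj X B) \<bullet> D = - (1/2) * ((transpose X ** B) \<bullet> (transpose D ** D))"
    by (simp add: tangent_proj_def flip: M_def)
  also have "(transpose X ** B) \<bullet> (transpose D ** D) = (D ** (transpose X ** B)) \<bullet> D"
    by (simp add: inner_matrix_mul_left [of D])
  also have "\<dots> = (\<Sum>i\<in>UNIV. (X *v D $ i) \<bullet> (B *v D $ i))"
    unfolding inner_matrix_mul_rows
    by (intro sum.cong refl) (metis dot_lmul_matrix matrix_vector_mul_assoc vector_transpose_matrix)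
  finally have "\<bar>(B - tangent_proj X B) \<bullet> D\<bar> = 1/2 * \<bar>\<Sum>i\<in>UNIV. (X *v D $ i) \<bullet> (B *v D $ i)\<bar>"
    by simp
  also have "\<bar>\<Sum>i\<in>UNIV. (X *v D $ i) \<bullet> (B *v D $ i)\<bar> \<le> (\<Sum>i\<in>UNIV. norm B * (D $ i \<bullet> D $ i))"
  proof (rule order_trans [OF sum_abs], rule sum_mono)
    fix i
    have "\<bar>(X *v D $ i) \<bullet> (B *v D $ i)\<bar> \<le> norm (X *v D $ i) * norm (B *v D $ i)"
      by (rule Cauchy_Schwarz_ineq2)
    also have "\<dots> \<le> norm (D $ i) * (norm B * norm (D $ i))"
      by (intro mult_mono norm_matrix_vector_le) (simp_all add: norm_Stiefel_mult_vector X)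
    finally show "\<bar>(X *v D $ i) \<bullet> (B *v D $ i)\<bar> \<le> norm B * (D $ i \<bullet> D $ i)"
      by (simp add: mult_ac power2_eq_square flip: power2_norm_eq_inner)
  qed
  also have "\<dots> = norm B * (norm D)\<^sup>2"
    by (simp add: power2_norm_eq_inner inner_vec_def [of D] sum_distrib_left)
  finally show ?thesis
    by (simp add: D_def)
qed

text \<open>
  Replacing the Euclidean subgradient by its tangential part costs, by the preceding bound,
  \<open>L / 2\<close> times the squared distance. So on the manifold \<open>h\<close> behaves like an
  \<open>(L + \<tau>)\<close>-weakly convex function.
\<close>

lemma riemannian_subgradient_inequality:
  fixes h :: "real^'r^'n \<Rightarrow> real"
  assumes U: "open U" "Stiefel \<subseteq> U" and lip: "L-lipschitz_on U h"
    and X: "X \<in> Stiefel" and Y: "Y \<in> Stiefel" and G: "G \<in> riem_subdiff \<tau> h X"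
  shows "h X + G \<bullet> (Y - X) - (L + \<tau>) / 2 * (norm (Y - X))\<^sup>2 \<le> h Y"
    and "norm G \<le> L" and "G \<in> tangent_space X"
proof -
  obtain B where B: "B \<in> subdiff \<tau> h X" and G': "G = tangent_proj X B"
    using G by (auto simp: riem_subdiff_def)
  have nB: "norm B \<le> L"
    using subdiff_norm_le_lipschitz [OF U(1) _ lip B] U(2) X by blast
  show "G \<in> tangent_space X"
    by (simp add: G' tangent_proj_in_tangent_space X)
  show "norm G \<le> L"
    using norm_tangent_proj_le [OF X, of B] nB by (simp add: G')
  have "norm B / 2 * (norm (Y - X))\<^sup>2 \<le> L / 2 * (norm (Y - X))\<^sup>2"
    using nB by (intro mult_right_mono) auto
  then have "- (L / 2 * (norm (Y - X))\<^sup>2) \<le> (B - G) \<bullet> (Y - X)"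
    using normal_component_bound [OF X Y, of B] by (simp add: G' abs_le_iff)
  with subdiff_lower_bound [OF B, of Y]
  show "h X + G \<bullet> (Y - X) - (L + \<tau>) / 2 * (norm (Y - X))\<^sup>2 \<le> h Y"
    by (simp add: inner_diff_left add_divide_distrib distrib_right)
qed

section \<open>One cycle of the incremental method\<close>

lemma retracted_subgradient_step:
  fixes h :: "real^'r^'n \<Rightarrow> real"
  assumes U: "open U" "Stiefel \<subseteq> U" and lip: "L-lipschitz_on U h" and "\<gamma> > 0"
    and X: "X \<in> Stiefel" and G: "G \<in> riem_subdiff \<tau> h X"
    and Z: "Z = polar_retr X (- \<gamma> *\<^sub>R G)"
  shows "Z \<in> Stiefel" and "norm (Z - X) \<le> \<gamma> * L"
    and "Y \<in> Stiefel \<Longrightarrow> (norm (Z - Y))\<^sup>2 \<le> (norm (X - Y))\<^sup>2 - 2 * \<gamma> * (h X - h Y)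
      + \<gamma> * (L + \<tau>) * (norm (X - Y))\<^sup>2 + \<gamma>\<^sup>2 * L\<^sup>2"
proof -
  note subgrad = riemannian_subgradient_inequality [OF U lip X _ G]
  have nG: "norm G \<le> L"
    by (rule subgrad(2) [OF X])
  have tan: "- \<gamma> *\<^sub>R G \<in> tangent_space X"
  proof -
    have "transpose G ** X + transpose X ** G = 0"
      using subgrad(3) [OF X] by (simp add: tangent_space_def)
    then have "- \<gamma> *\<^sub>R (transpose G ** X + transpose X ** G) = 0"
      by simp
    then show ?thesis
      by (simp only: tangent_space_def transpose_linear matrix_mul_linear mem_Collect_eq
          scaleR_right_distrib)
  qed
  show "Z \<in> Stiefel"
    unfolding Z by (rule polar_retr_decomposition(1) [OF X tan])
  show "norm (Z - X) \<le> \<gamma> * L"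
    using polar_retr_closer [OF X tan X] nG \<open>\<gamma> > 0\<close> unfolding Z
    by (simp add: order_trans [OF _ mult_left_mono])
  assume Y: "Y \<in> Stiefel"
  have "(norm (Z - Y))\<^sup>2 \<le> (norm (X + - \<gamma> *\<^sub>R G - Y))\<^sup>2"
    unfolding Z by (intro power_mono polar_retr_closer X tan Y) simp
  also have "X + - \<gamma> *\<^sub>R G - Y = (X - Y) - \<gamma> *\<^sub>R G"
    by simp
  also have "(norm \<dots>)\<^sup>2 = (norm (X - Y))\<^sup>2 - 2 * \<gamma> * (G \<bullet> (X - Y)) + \<gamma>\<^sup>2 * (norm G)\<^sup>2"
    unfolding power2_norm_eq_inner inner_diff_left [of "X - Y"] inner_diff_right [of _ "X - Y"]
    by (simp add: inner_commute power2_eq_square)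
  also have "\<dots> = (norm (X - Y))\<^sup>2 + 2 * \<gamma> * (G \<bullet> (Y - X)) + \<gamma>\<^sup>2 * (norm G)\<^sup>2"
    by (simp add: inner_diff_right algebra_simps)
  also have "\<gamma>\<^sup>2 * (norm G)\<^sup>2 \<le> \<gamma>\<^sup>2 * L\<^sup>2"
    using nG by (intro mult_left_mono power_mono) auto
  also have "2 * \<gamma> * (G \<bullet> (Y - X)) \<le> 2 * \<gamma> * (h Y - h X + (L + \<tau>) / 2 * (norm (X - Y))\<^sup>2)"
    using subgrad(1) [OF Y] \<open>\<gamma> > 0\<close> by (intro mult_left_mono) (auto simp: norm_minus_commute)
  finally show "(norm (Z - Y))\<^sup>2 \<le> (norm (X - Y))\<^sup>2 - 2 * \<gamma> * (h X - h Y)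
      + \<gamma> * (L + \<tau>) * (norm (X - Y))\<^sup>2 + \<gamma>\<^sup>2 * L\<^sup>2"
    by (simp add: field_simps)
qed

lemma incremental_cycle_drift:
  fixes Z :: "nat \<Rightarrow> 'a::real_normed_vector"
  assumes "\<And>i. i \<in> {1..m} \<Longrightarrow> norm (Z i - Z (i - 1)) \<le> s" and "j \<le> m"
  shows "norm (Z j - Z 0) \<le> real j * s"
  using assms(2)
proof (induction j)
  case (Suc j)
  have "norm (Z (Suc j) - Z 0) \<le> norm (Z (Suc j) - Z j) + norm (Z j - Z 0)"
    using norm_triangle_ineq [of "Z (Suc j) - Z j" "Z j - Z 0"] by simp
  with Suc assms(1) [of "Suc j"] show ?case
    by (simp add: distrib_right)
qed simp

text \<open>
  Summing the descent inequalities over a cycle needs values and distances at the start \<open>Z 0\<close> of the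
  cycle in place of those at the current inner iterate. The drift after \<open>i\<close> steps is at most
  \<open>i \<gamma> L\<close>: this enters the function values linearly, giving with the terms \<open>\<gamma>\<^sup>2 L\<^sup>2\<close> the sum
  of \<open>2 i + 1\<close>, which is \<open>j\<^sup>2\<close>, and the squared distances through \<open>(s + a)\<^sup>2 \<le> 2 s\<^sup>2 + 2 a\<^sup>2\<close>, giving
  the sum of \<open>2 i\<^sup>2\<close>, which is \<open>(j - 1) j (2 j - 1) / 3\<close>.
\<close>

lemma incremental_cycle_estimate:
  fixes Z :: "nat \<Rightarrow> 'a::real_normed_vector" and f :: "nat \<Rightarrow> 'a \<Rightarrow> real"
  assumes nonneg: "\<gamma> \<ge> 0" "L \<ge> 0" "c \<ge> 0"
    and move: "\<And>i. i \<in> {1..m} \<Longrightarrow> norm (Z i - Z (i - 1)) \<le> \<gamma> * L"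
    and lip: "\<And>i. i \<in> {1..m} \<Longrightarrow> f i (Z 0) - f i (Z (i - 1)) \<le> L * norm (Z (i - 1) - Z 0)"
    and descent: "\<And>i. i \<in> {1..m} \<Longrightarrow> (norm (Z i - Y))\<^sup>2 \<le> (norm (Z (i - 1) - Y))\<^sup>2
      - 2 * \<gamma> * (f i (Z (i - 1)) - f i Y) + \<gamma> * c * (norm (Z (i - 1) - Y))\<^sup>2 + \<gamma>\<^sup>2 * L\<^sup>2"
    and "j \<le> m"
  shows "(norm (Z j - Y))\<^sup>2 \<le> (1 + 2 * real j * \<gamma> * c) * (norm (Z 0 - Y))\<^sup>2
      - 2 * \<gamma> * (\<Sum>i=1..j. f i (Z 0) - f i Y) + (real j)\<^sup>2 * (\<gamma> * L)\<^sup>2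
      + \<gamma> * c * (\<gamma> * L)\<^sup>2 * ((real j - 1) * real j * (2 * real j - 1) / 3)"
  using \<open>j \<le> m\<close>
proof (induction j)
  case (Suc j)
  define a where "a = norm (Z 0 - Y)"
  define s where "s = real j * (\<gamma> * L)"
  have s: "s \<ge> 0" using nonneg by (simp add: s_def)
  have drift: "norm (Z j - Z 0) \<le> s"
    unfolding s_def by (rule incremental_cycle_drift [of m]) (use move Suc.prems in auto)
  have "norm (Z j - Y) \<le> s + a"
    using norm_triangle_ineq [of "Z j - Z 0" "Z 0 - Y"] drift by (simp add: a_def)
  then have "(norm (Z j - Y))\<^sup>2 \<le> (s + a)\<^sup>2"
    by (intro power_mono) auto
  also have "\<dots> \<le> 2 * a\<^sup>2 + 2 * s\<^sup>2"
    using sum_squares_bound [of s a] by (simp add: power2_sum)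
  finally have "\<gamma> * c * (norm (Z j - Y))\<^sup>2 \<le> \<gamma> * c * (2 * a\<^sup>2 + 2 * s\<^sup>2)"
    using nonneg by (intro mult_left_mono) auto
  moreover have "L * norm (Z j - Z 0) \<le> L * s"
    using drift nonneg by (intro mult_left_mono) auto
  with lip [of "Suc j"] Suc.prems have "f (Suc j) (Z 0) - f (Suc j) (Z j) \<le> L * s"
    by simp
  then have "2 * \<gamma> * (f (Suc j) (Z 0) - f (Suc j) (Z j)) \<le> 2 * \<gamma> * (L * s)"
    using nonneg by (intro mult_left_mono) auto
  moreover have "(norm (Z (Suc j) - Y))\<^sup>2 \<le> (norm (Z j - Y))\<^sup>2
      - 2 * \<gamma> * (f (Suc j) (Z j) - f (Suc j) Y) + \<gamma> * c * (norm (Z j - Y))\<^sup>2 + \<gamma>\<^sup>2 * L\<^sup>2"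
    using descent [of "Suc j"] Suc.prems by simp
  ultimately have "(norm (Z (Suc j) - Y))\<^sup>2 \<le> (norm (Z j - Y))\<^sup>2
      - 2 * \<gamma> * (f (Suc j) (Z 0) - f (Suc j) Y) + 2 * \<gamma> * (L * s)
      + \<gamma> * c * (2 * a\<^sup>2 + 2 * s\<^sup>2) + \<gamma>\<^sup>2 * L\<^sup>2"
    by (simp add: right_diff_distrib)
  also have "\<dots> \<le> (1 + 2 * real j * \<gamma> * c) * a\<^sup>2
      - 2 * \<gamma> * (\<Sum>i=1..j. f i (Z 0) - f i Y) + (real j)\<^sup>2 * (\<gamma> * L)\<^sup>2
      + \<gamma> * c * (\<gamma> * L)\<^sup>2 * ((real j - 1) * real j * (2 * real j - 1) / 3)
      - 2 * \<gamma> * (f (Suc j) (Z 0) - f (Suc j) Y) + 2 * \<gamma> * (L * s)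
      + \<gamma> * c * (2 * a\<^sup>2 + 2 * s\<^sup>2) + \<gamma>\<^sup>2 * L\<^sup>2"
    using Suc by (simp add: a_def)
  also have "\<dots> = (1 + 2 * real (Suc j) * \<gamma> * c) * a\<^sup>2
      - 2 * \<gamma> * (\<Sum>i=1..Suc j. f i (Z 0) - f i Y) + (real (Suc j))\<^sup>2 * (\<gamma> * L)\<^sup>2
      + \<gamma> * c * (\<gamma> * L)\<^sup>2 * ((real (Suc j) - 1) * real (Suc j) * (2 * real (Suc j) - 1) / 3)"
    by (simp add: s_def field_simps power2_eq_square)
  finally show ?case
    by (simp only: a_def)
qed simp

text \<open>
  The smallness of the stepsize turns the cubic term in \<open>\<gamma>\<close> of the general estimate into a quadratic
  one; it contributes \<open>(m - 1) (2 m - 1) / 3\<close> to the constant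
  \<open>5/3 m\<^sup>2 - m + 1/3 = m\<^sup>2 + (m - 1) (2 m - 1) / 3\<close>.
\<close>

lemma riem_incremental_cycle:
  fixes f :: "nat \<Rightarrow> real^'r^'n \<Rightarrow> real"
  assumes U: "open U" "Stiefel \<subseteq> U" and lip: "\<And>i. i \<in> {1..m} \<Longrightarrow> L-lipschitz_on U (f i)"
    and "m \<ge> 1" "L > 0" "\<tau> \<ge> 0" "\<gamma> > 0" and small: "real m * (\<gamma> * (L + \<tau>)) \<le> 1"
    and Z0: "Z 0 \<in> Stiefel"
    and Z: "\<And>i. i \<in> {1..m} \<Longrightarrow> \<exists>G \<in> riem_subdiff \<tau> (f i) (Z (i - 1)).
            Z i = polar_retr (Z (i - 1)) (- \<gamma> *\<^sub>R G)"
  shows "Z m \<in> Stiefel"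
    and "Y \<in> Stiefel \<Longrightarrow> (norm (Z m - Y))\<^sup>2
      \<le> (1 + 2 * real m * \<gamma> * (L + \<tau>)) * (norm (Z 0 - Y))\<^sup>2
        - 2 * \<gamma> * (\<Sum>i=1..m. f i (Z 0) - f i Y)
        + (5/3 * (real m)\<^sup>2 - real m + 1/3) * L\<^sup>2 * \<gamma>\<^sup>2"
proof -
  have St: "Z i \<in> Stiefel" if "i \<le> m" for i
    using that
  proof (induction i)
    case (Suc i)
    then have i: "Suc i \<in> {1..m}" and prev: "Z i \<in> Stiefel"
      by auto
    obtain G where "G \<in> riem_subdiff \<tau> (f (Suc i)) (Z i)" "Z (Suc i) = polar_retr (Z i) (- \<gamma> *\<^sub>R G)"
      using Z [OF i] by auto
    then show ?case
      by (rule retracted_subgradient_step(1) [OF U lip [OF i] \<open>\<gamma> > 0\<close> prev])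
  qed (simp add: Z0)
  then show "Z m \<in> Stiefel" by simp
  assume Y: "Y \<in> Stiefel"
  have prev: "Z (i - 1) \<in> Stiefel" if "i \<in> {1..m}" for i
    using St that by auto
  have move: "norm (Z i - Z (i - 1)) \<le> \<gamma> * L" if "i \<in> {1..m}" for i
    using Z [OF that] retracted_subgradient_step(2) [OF U lip [OF that] \<open>\<gamma> > 0\<close> prev [OF that]] by blast
  have descent: "(norm (Z i - Y))\<^sup>2 \<le> (norm (Z (i - 1) - Y))\<^sup>2
      - 2 * \<gamma> * (f i (Z (i - 1)) - f i Y) + \<gamma> * (L + \<tau>) * (norm (Z (i - 1) - Y))\<^sup>2 + \<gamma>\<^sup>2 * L\<^sup>2"
    if "i \<in> {1..m}" for i
    using Z [OF that] retracted_subgradient_step(3) [OF U lip [OF that] \<open>\<gamma> > 0\<close> prev [OF that] _ _ Y] by blast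
  have close: "f i (Z 0) - f i (Z (i - 1)) \<le> L * norm (Z (i - 1) - Z 0)" if "i \<in> {1..m}" for i
  proof -
    have "dist (f i (Z 0)) (f i (Z (i - 1))) \<le> L * dist (Z 0) (Z (i - 1))"
      using U(2) Z0 prev [OF that] by (intro lipschitz_onD [OF lip [OF that]]) auto
    then show ?thesis
      by (simp add: dist_norm norm_minus_commute abs_le_iff)
  qed
  define M where "M = real m"
  have M: "M \<ge> 1" using \<open>m \<ge> 1\<close> by (simp add: M_def)
  have "(norm (Z m - Y))\<^sup>2 \<le> (1 + 2 * M * \<gamma> * (L + \<tau>)) * (norm (Z 0 - Y))\<^sup>2
      - 2 * \<gamma> * (\<Sum>i=1..m. f i (Z 0) - f i Y) + M\<^sup>2 * (\<gamma> * L)\<^sup>2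
      + \<gamma> * (L + \<tau>) * (\<gamma> * L)\<^sup>2 * ((M - 1) * M * (2 * M - 1) / 3)"
    unfolding M_def
    by (rule incremental_cycle_estimate [OF _ _ _ move close descent order_refl])
       (use \<open>L > 0\<close> \<open>\<tau> \<ge> 0\<close> \<open>\<gamma> > 0\<close> in simp_all)
  also have "\<gamma> * (L + \<tau>) * (\<gamma> * L)\<^sup>2 * ((M - 1) * M * (2 * M - 1) / 3)
      = (M * (\<gamma> * (L + \<tau>))) * ((\<gamma> * L)\<^sup>2 * ((M - 1) * (2 * M - 1) / 3))"
    by (simp add: mult_ac)
  also have "\<dots> \<le> 1 * ((\<gamma> * L)\<^sup>2 * ((M - 1) * (2 * M - 1) / 3))"
    using small M by (intro mult_right_mono) (auto simp: M_def)
  also have "(1 + 2 * M * \<gamma> * (L + \<tau>)) * (norm (Z 0 - Y))\<^sup>2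
      - 2 * \<gamma> * (\<Sum>i=1..m. f i (Z 0) - f i Y) + M\<^sup>2 * (\<gamma> * L)\<^sup>2
      + 1 * ((\<gamma> * L)\<^sup>2 * ((M - 1) * (2 * M - 1) / 3))
    = (1 + 2 * M * \<gamma> * (L + \<tau>)) * (norm (Z 0 - Y))\<^sup>2
      - 2 * \<gamma> * (\<Sum>i=1..m. f i (Z 0) - f i Y) + (5/3 * M\<^sup>2 - M + 1/3) * L\<^sup>2 * \<gamma>\<^sup>2"
    by (simp add: field_simps power2_eq_square)
  finally show "(norm (Z m - Y))\<^sup>2 \<le> (1 + 2 * real m * \<gamma> * (L + \<tau>)) * (norm (Z 0 - Y))\<^sup>2
      - 2 * \<gamma> * (\<Sum>i=1..m. f i (Z 0) - f i Y)
      + (5/3 * (real m)\<^sup>2 - real m + 1/3) * L\<^sup>2 * \<gamma>\<^sup>2"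
    by (simp add: M_def)
qed

lemma le_infdist_squared:
  assumes "A \<noteq> {}" "a > 0" and le: "\<And>y. y \<in> A \<Longrightarrow> p \<le> a * (dist x y)\<^sup>2 + q"
  shows "p \<le> a * (infdist x A)\<^sup>2 + q"
proof -
  have "sqrt ((p - q) / a) \<le> dist x y" if "y \<in> A" for y
  proof -
    have "(p - q) / a \<le> (dist x y)\<^sup>2"
      using le [OF that] \<open>a > 0\<close> by (simp add: divide_le_eq mult.commute)
    then show ?thesis
      by (intro real_le_lsqrt) auto
  qed
  then have "sqrt ((p - q) / a) \<le> infdist x A"
    unfolding infdist_notempty [OF assms(1)] by (intro cINF_greatest assms(1))
  then have "(p - q) / a \<le> (infdist x A)\<^sup>2"
    by (rule sqrt_le_D)
  then show ?thesis
    using \<open>a > 0\<close> by (simp add: divide_le_eq mult.commute)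
qed

text \<open>
  The cycle estimate holds for every \<open>Y\<close> in the solution set, and sharpness bounds the decrease of
  the objective independently of \<open>Y\<close>. The infimum over \<open>Y\<close> is therefore taken only
  at the end, which also covers sets without nearest points.
\<close>

lemma riem_incremental_distance_recursion:
  fixes f :: "nat \<Rightarrow> real^'r^'n \<Rightarrow> real"
  assumes U: "open U" "Stiefel \<subseteq> U" and lip: "\<And>i. i \<in> {1..m} \<Longrightarrow> L-lipschitz_on U (f i)"
    and pos: "m \<ge> 1" "L > 0" "\<tau> \<ge> 0" "\<gamma> > 0" and small: "real m * (\<gamma> * (L + \<tau>)) \<le> 1"
    and sharp: "weak_sharp_minima (\<lambda>Y. (1 / real m) * (\<Sum>i=1..m. f i Y)) \<X> \<alpha> \<rho>"
    and Z0: "Z 0 \<in> Stiefel" and near: "infdist (Z 0) \<X> < \<rho>"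
    and Z: "\<And>i. i \<in> {1..m} \<Longrightarrow> \<exists>G \<in> riem_subdiff \<tau> (f i) (Z (i - 1)).
            Z i = polar_retr (Z (i - 1)) (- \<gamma> *\<^sub>R G)"
  shows "(infdist (Z m) \<X>)\<^sup>2 \<le> (1 + 2 * real m * \<gamma> * (L + \<tau>)) * (infdist (Z 0) \<X>)\<^sup>2
    - 2 * real m * \<gamma> * \<alpha> * infdist (Z 0) \<X> + (5/3 * (real m)\<^sup>2 - real m + 1/3) * L\<^sup>2 * \<gamma>\<^sup>2"
proof -
  define \<delta> where "\<delta> = infdist (Z 0) \<X>"
  define q where "q = - 2 * real m * \<gamma> * \<alpha> * \<delta> + (5/3 * (real m)\<^sup>2 - real m + 1/3) * L\<^sup>2 * \<gamma>\<^sup>2"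
  have sub: "\<X> \<noteq> {}" "\<X> \<subseteq> Stiefel"
    using sharp by (auto simp: weak_sharp_minima_def)
  have "(infdist (Z m) \<X>)\<^sup>2 \<le> (1 + 2 * real m * \<gamma> * (L + \<tau>)) * (dist (Z 0) Y)\<^sup>2 + q"
    if Y: "Y \<in> \<X>" for Y
  proof -
    have "\<alpha> * \<delta> \<le> (1 / real m) * (\<Sum>i=1..m. f i (Z 0)) - (1 / real m) * (\<Sum>i=1..m. f i Y)"
      using sharp Z0 near Y unfolding weak_sharp_minima_def \<delta>_def by blast
    then have "\<alpha> * \<delta> * real m \<le> (\<Sum>i=1..m. f i (Z 0) - f i Y)"
      using pos(1) by (simp add: le_divide_eq sum_subtractf flip: diff_divide_distrib)
    then have "2 * \<gamma> * (\<alpha> * \<delta> * real m) \<le> 2 * \<gamma> * (\<Sum>i=1..m. f i (Z 0) - f i Y)"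
      using pos by (intro mult_left_mono) auto
    moreover have "(infdist (Z m) \<X>)\<^sup>2 \<le> (norm (Z m - Y))\<^sup>2"
      using infdist_le [OF Y, of "Z m"] by (intro power_mono) (auto simp: dist_norm infdist_nonneg)
    moreover have "Y \<in> Stiefel"
      using Y sub by blast
    note riem_incremental_cycle(2) [OF U lip pos small Z0 Z this]
    ultimately show ?thesis
      by (simp add: q_def dist_norm mult_ac)
  qed
  then have "(infdist (Z m) \<X>)\<^sup>2 \<le> (1 + 2 * real m * \<gamma> * (L + \<tau>)) * \<delta>\<^sup>2 + q"
    unfolding \<delta>_def using sub(1) pos by (intro le_infdist_squared) (auto intro: add_pos_nonneg)
  then show ?thesis
    by (simp add: q_def \<delta>_def)
qed

section \<open>Linear convergence\<close>

text \<open>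
  A function cannot grow faster than its Lipschitz constant allows, provided that some point near the
  solution set lies off its closure.
\<close>

lemma weak_sharp_minima_sharpness_le_lipschitz:
  fixes h :: "real^'r^'n \<Rightarrow> real"
  assumes sharp: "weak_sharp_minima h \<X> \<alpha> \<rho>" and lip: "L-lipschitz_on Stiefel h"
    and X: "X \<in> Stiefel" "0 < infdist X \<X>" "infdist X \<X> < \<rho>"
  shows "\<alpha> \<le> L"
proof -
  have sub: "\<X> \<noteq> {}" "\<X> \<subseteq> Stiefel"
    using sharp by (auto simp: weak_sharp_minima_def)
  have le: "\<alpha> * infdist X \<X> \<le> L * dist X Y" if "Y \<in> \<X>" for Y
  proof -
    have "\<alpha> * infdist X \<X> \<le> h X - h Y"
      using sharp X that unfolding weak_sharp_minima_def by blast
    also have "\<dots> \<le> L * dist X Y"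
      using lipschitz_onD [OF lip, of X Y] X(1) sub(2) that by (auto simp: dist_real_def)
    finally show ?thesis .
  qed
  have "\<alpha> > 0"
    using sharp by (simp add: weak_sharp_minima_def)
  obtain Y where "Y \<in> \<X>"
    using sub(1) by blast
  with le have "L * dist X Y > 0"
    using \<open>\<alpha> > 0\<close> X(2) by (meson less_le_trans mult_pos_pos)
  then have "L > 0"
    using lipschitz_on_nonneg [OF lip] by (simp add: zero_less_mult_iff)
  have "\<alpha> * infdist X \<X> / L \<le> infdist X \<X>"
    unfolding infdist_notempty [OF sub(1)]
    by (rule cINF_greatest [OF sub(1)])
       (use le \<open>L > 0\<close> in \<open>simp add: divide_le_eq mult.commute infdist_notempty [OF sub(1)]\<close>)
  then show ?thesis
    using \<open>L > 0\<close> X(2) by (simp add: divide_le_eq mult.commute)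
qed

lemma lipschitz_on_average:
  fixes f :: "nat \<Rightarrow> 'a::metric_space \<Rightarrow> real"
  assumes "m \<ge> 1" "\<And>i. i \<in> {1..m} \<Longrightarrow> L-lipschitz_on U (f i)"
  shows "L-lipschitz_on U (\<lambda>x. (1 / real m) * (\<Sum>i=1..m. f i x))"
proof (rule lipschitz_onI)
  fix x y assume "x \<in> U" "y \<in> U"
  then have "dist (f i x) (f i y) \<le> L * dist x y" if "i \<in> {1..m}" for i
    using assms(2) [OF that] by (simp add: lipschitz_onD)
  then have "\<bar>\<Sum>i=1..m. f i x - f i y\<bar> \<le> (\<Sum>i=1..m. L * dist x y)"
    by (intro order_trans [OF sum_abs] sum_mono) (auto simp: dist_real_def)
  then show "dist ((1 / real m) * (\<Sum>i=1..m. f i x)) ((1 / real m) * (\<Sum>i=1..m. f i y)) \<le> L * dist x y"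
    using assms(1) by (simp add: dist_real_def sum_subtractf divide_le_eq mult.commute
        flip: diff_divide_distrib)
next
  show "0 \<le> L"
    using assms lipschitz_on_nonneg [of L U "f 1"] by auto
qed

text \<open>
  The cycle estimate requires \<open>m \<gamma> (L + \<tau>) \<le> 1\<close>, which is hidden in the two upper bounds on the
  stepsize. Here \<open>c\<close> stands for \<open>L + \<tau>\<close> and \<open>M\<close> for the number of components.
\<close>

lemma stepsize_bound:
  fixes M c e \<alpha> \<gamma> d L :: real
  assumes "M > 0" "c > 0" "e > 0" "L > 0" "\<gamma> > 0" and gap: "c * e < \<alpha>" and d: "M\<^sup>2 \<le> d"
    and \<gamma>1: "\<gamma> < 2 * M * e * (\<alpha> - c * e) / (d * L\<^sup>2)"
    and \<gamma>2: "\<gamma> < e / (2 * M * (\<alpha> - c * e))"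
    and alt: "\<alpha> \<le> L \<or> 2 * (c * e) \<le> \<alpha>"
  shows "M * (\<gamma> * c) \<le> 1"
  using alt
proof
  \<comment> \<open>Far from the critical radius \<open>\<alpha> / c\<close> the second stepsize bound suffices.\<close>
  assume "2 * (c * e) \<le> \<alpha>"
  have "\<gamma> * (2 * M * (\<alpha> - c * e)) \<le> e"
    using \<gamma>2 gap \<open>M > 0\<close> by (simp add: less_divide_eq)
  then have "c * (\<gamma> * (2 * M * (\<alpha> - c * e))) \<le> c * e"
    using \<open>c > 0\<close> by simp
  also have "\<dots> \<le> 2 * (\<alpha> - c * e)"
    using \<open>2 * (c * e) \<le> \<alpha>\<close> gap by simp
  finally have "(M * (\<gamma> * c)) * (2 * (\<alpha> - c * e)) \<le> 1 * (2 * (\<alpha> - c * e))"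
    by (simp add: mult_ac)
  then show ?thesis
    using gap by (subst (asm) mult_le_cancel_right) auto
next
  \<comment> \<open>If \<open>\<alpha> \<le> L\<close>, then the first one does, by \<open>2 x (\<alpha> - x) \<le> \<alpha>\<^sup>2 \<le> L\<^sup>2\<close> for \<open>x = c e\<close>.\<close>
  assume "\<alpha> \<le> L"
  have "d > 0" using d \<open>M > 0\<close> by (meson less_le_trans zero_less_power)
  have "\<gamma> * (M\<^sup>2 * L\<^sup>2) \<le> \<gamma> * (d * L\<^sup>2)"
    using d \<open>\<gamma> > 0\<close> by (intro mult_left_mono mult_right_mono) auto
  also have "\<dots> \<le> 2 * M * e * (\<alpha> - c * e)"
    using \<gamma>1 \<open>d > 0\<close> \<open>L > 0\<close> by (simp add: less_divide_eq)
  finally have "M * (M * \<gamma> * L\<^sup>2) \<le> M * (2 * e * (\<alpha> - c * e))"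
    by (simp add: power2_eq_square mult_ac)
  then have "M * \<gamma> * L\<^sup>2 \<le> 2 * e * (\<alpha> - c * e)"
    using \<open>M > 0\<close> by simp
  then have "c * (M * \<gamma> * L\<^sup>2) \<le> c * (2 * e * (\<alpha> - c * e))"
    using \<open>c > 0\<close> by simp
  also have "\<dots> = 2 * ((c * e) * (\<alpha> - c * e))"
    by (simp add: mult_ac)
  also have "\<dots> \<le> \<alpha>\<^sup>2"
    using sum_squares_bound [of "c * e" "\<alpha> - c * e"] zero_le_power2 [of "c * e"]
      zero_le_power2 [of "\<alpha> - c * e"]
    by (simp add: power2_eq_square algebra_simps)
  also have "\<dots> \<le> L\<^sup>2"
    using \<open>\<alpha> \<le> L\<close> gap mult_pos_pos [OF \<open>c > 0\<close> \<open>e > 0\<close>] by (intro power_mono) auto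
  finally have "(M * (\<gamma> * c)) * L\<^sup>2 \<le> 1 * L\<^sup>2"
    by (simp add: mult_ac)
  then show ?thesis
    using \<open>L > 0\<close> by (subst (asm) mult_le_cancel_right) auto
qed

text \<open>
  One cycle at scale \<open>B = \<beta> ^ k\<close>. The bound \<open>\<delta> \<le> e\<close>, rather than the sharper \<open>\<delta> \<le> B e\<close>, is used to
  absorb the curvature term into the sharpness term. What remains, \<open>\<delta> (\<delta> - B \<kappa>)\<close>, is convex in
  \<open>\<delta>\<close>, and \<open>\<kappa> \<le> e\<close> ensures that its maximum on \<open>[0, B e]\<close> is attained at the right end; the
  factor \<open>B\<^sup>2\<close> then comes out.
\<close>

lemma geometric_contraction:
  fixes B e \<delta> \<kappa> c M \<alpha> \<gamma> R :: real
  assumes B: "0 \<le> B" "B \<le> 1" and "c \<ge> 0" "M \<ge> 0" "\<gamma> \<ge> 0"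
    and \<delta>: "0 \<le> \<delta>" "\<delta> \<le> B * e"
    and \<kappa>: "\<kappa> = 2 * M * \<gamma> * (\<alpha> - c * e)" "0 \<le> \<kappa>" "\<kappa> \<le> e"
    and rec: "p \<le> (1 + 2 * M * (B * \<gamma>) * c) * \<delta>\<^sup>2 - 2 * M * (B * \<gamma>) * \<alpha> * \<delta> + R * (B * \<gamma>)\<^sup>2"
  shows "p \<le> B\<^sup>2 * (e\<^sup>2 - \<kappa> * e + R * \<gamma>\<^sup>2)"
proof -
  have e: "0 \<le> e" using \<kappa> by simp
  then have "B * e \<le> 1 * e"
    using B by (intro mult_right_mono) auto
  then have "\<delta> * \<delta> \<le> e * \<delta>"
    using \<delta> by (intro mult_right_mono) auto
  then have "2 * M * (B * \<gamma>) * c * \<delta>\<^sup>2 \<le> 2 * M * (B * \<gamma>) * c * (e * \<delta>)"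
    using assms by (intro mult_left_mono) (auto simp: power2_eq_square)
  then have "p \<le> \<delta> * (\<delta> - B * \<kappa>) + R * (B * \<gamma>)\<^sup>2"
    using rec by (simp add: \<kappa>(1) power2_eq_square algebra_simps)
  also have "\<delta> * (\<delta> - B * \<kappa>) \<le> (B * e) * (B * e - B * \<kappa>)"
  proof (cases "B * \<kappa> \<le> \<delta>")
    case True
    then show ?thesis using \<delta> by (intro mult_mono) auto
  next
    case False
    then have "\<delta> * (\<delta> - B * \<kappa>) \<le> 0"
      using \<delta> by (intro mult_nonneg_nonpos) auto
    also have "0 \<le> (B * e) * (B * e - B * \<kappa>)"
      using B e \<kappa> by (simp add: mult_left_mono)
    finally show ?thesis .
  qed
  finally show ?thesis
    by (simp add: power2_eq_square algebra_simps)
qed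

theorem theorem4:
  fixes f :: "nat \<Rightarrow> real^'r^'n \<Rightarrow> real"
    and m :: nat
    and \<U> \<X> :: "(real^'r^'n) set"
    and X :: "nat \<Rightarrow> real^'r^'n"
    and \<gamma> :: "nat \<Rightarrow> real"
    and \<tau> L \<alpha> \<rho> \<beta> \<beta>\<^sub>m\<^sub>i\<^sub>n d e\<^sub>0 :: real
  assumes "m \<ge> 1"
    and "\<tau> \<ge> 0"
    and "\<And>i. i \<in> {1..m} \<Longrightarrow> weakly_convex \<tau> (f i)"
    and "bounded \<U>" and "open \<U>" and "convex \<U>" and "Stiefel \<subseteq> \<U>"
    and "L > 0"
    and "\<And>i. i \<in> {1..m} \<Longrightarrow> L-lipschitz_on \<U> (f i)"
    and "weak_sharp_minima (\<lambda>Y. (1 / real m) * (\<Sum>i=1..m. f i Y)) \<X> \<alpha> \<rho>"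
    and "riem_incremental_subgrad \<tau> m f \<gamma> X"
    and "infdist (X 0) \<X> < min (\<alpha> / (L + \<tau>)) \<rho>"
    and "d = 5/3 * (real m)\<^sup>2 - real m + 1/3"
    and "e\<^sub>0 = min (max (infdist (X 0) \<X>) (\<alpha> / (2 * (L + \<tau>)))) \<rho>"
    and "\<And>k. \<gamma> k = \<beta> ^ k * \<gamma> 0"
    and "0 < \<gamma> 0"
    and "\<gamma> 0 < min (2 * real m * e\<^sub>0 * (\<alpha> - (L + \<tau>) * e\<^sub>0) / (d * L\<^sup>2))
                   (e\<^sub>0 / (2 * real m * (\<alpha> - (L + \<tau>) * e\<^sub>0)))"
    and "\<beta>\<^sub>m\<^sub>i\<^sub>n = sqrt (1 + 2 * real m * (L + \<tau> - \<alpha> / e\<^sub>0) * \<gamma> 0 + d * L\<^sup>2 / e\<^sub>0\<^sup>2 * (\<gamma> 0)\<^sup>2)"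
    and "\<beta>\<^sub>m\<^sub>i\<^sub>n \<le> \<beta>" and "\<beta> < 1"
  shows "\<forall>k. infdist (X k) \<X> \<le> \<beta> ^ k * e\<^sub>0"
proof -
  define c where "c = L + \<tau>"
  define M where "M = real m"
  define g where "g = \<gamma> 0"
  define \<delta>0 where "\<delta>0 = infdist (X 0) \<X>"
  define \<kappa> where "\<kappa> = 2 * M * g * (\<alpha> - c * e\<^sub>0)"
  have pos: "c > 0" "M \<ge> 1" "g > 0" "\<alpha> > 0" "\<rho> > 0" "\<delta>0 \<ge> 0"
    using assms(1,2,8,10,16) by (auto simp: c_def M_def g_def weak_sharp_minima_def \<delta>0_def infdist_nonneg)
  have \<delta>0: "\<delta>0 < \<alpha> / c" "\<delta>0 < \<rho>" and e0: "e\<^sub>0 = min (max \<delta>0 (\<alpha> / (2 * c))) \<rho>"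
    using assms(12,14) by (simp_all add: \<delta>0_def c_def)
  have "\<alpha> / (2 * c) < \<alpha> / c" "0 < \<alpha> / (2 * c)"
    using pos by (simp_all add: field_simps)
  with \<delta>0 e0 pos have e: "0 < e\<^sub>0" "e\<^sub>0 < \<alpha> / c" "\<delta>0 \<le> e\<^sub>0" "e\<^sub>0 \<le> \<rho>"
    by auto
  have gap: "c * e\<^sub>0 < \<alpha>"
    using e(2) pos by (simp add: less_divide_eq mult.commute)
  obtain Z where Z0: "\<And>k. Z k 0 = X k" and Zm: "\<And>k. X (Suc k) = Z k m"
    and Z: "\<And>k i. i \<in> {1..m} \<Longrightarrow> \<exists>G \<in> riem_subdiff \<tau> (f i) (Z k (i - 1)).
            Z k i = polar_retr (Z k (i - 1)) (- \<gamma> k *\<^sub>R G)"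
    and X0: "X 0 \<in> Stiefel" and \<gamma>pos: "\<And>k. \<gamma> k > 0"
    using assms(11) unfolding riem_incremental_subgrad_def by blast

  \<comment> \<open>If \<open>X 0\<close> is at distance zero, sharpness gives no relation between \<open>\<alpha>\<close> and \<open>L\<close>, but then
      \<open>e\<^sub>0\<close> is at most half of the critical radius \<open>\<alpha> / c\<close>.\<close>
  have "\<alpha> \<le> L \<or> 2 * (c * e\<^sub>0) \<le> \<alpha>"
  proof (cases "\<delta>0 = 0")
    case True
    then have "e\<^sub>0 \<le> \<alpha> / (2 * c)"
      using e0 pos by auto
    then show ?thesis
      using pos by (simp add: le_divide_eq mult_ac)
  next
    case False
    have "L-lipschitz_on Stiefel (\<lambda>Y. (1 / real m) * (\<Sum>i=1..m. f i Y))"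
      by (rule lipschitz_on_subset [OF lipschitz_on_average]) (use assms(1,7,9) in auto)
    with assms(10) have "\<alpha> \<le> L"
      by (rule weak_sharp_minima_sharpness_le_lipschitz [of _ _ _ _ _ "X 0"])
         (use X0 False pos \<delta>0 in \<open>auto simp: \<delta>0_def\<close>)
    then show ?thesis ..
  qed
  moreover have "M\<^sup>2 \<le> d"
  proof -
    have "0 \<le> (M - 1) * (2 * M - 1)"
      using pos by (intro mult_nonneg_nonneg) auto
    then show ?thesis
      by (simp add: assms(13) M_def [symmetric] power2_eq_square algebra_simps)
  qed
  ultimately have small0: "M * (g * c) \<le> 1"
    using assms(8,17) pos e gap
    by (intro stepsize_bound [of M c e\<^sub>0 L g \<alpha> d]) (auto simp: M_def g_def c_def)

  have "0 < 2 * M * (\<alpha> - c * e\<^sub>0)"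
    using pos gap by simp
  moreover have "g < e\<^sub>0 / (2 * M * (\<alpha> - c * e\<^sub>0))"
    using assms(17) by (simp add: M_def g_def c_def)
  ultimately have \<kappa>: "0 \<le> \<kappa>" "\<kappa> \<le> e\<^sub>0"
    using pos gap by (simp_all add: \<kappa>_def pos_less_divide_eq mult_ac)
  have "0 \<le> d * L\<^sup>2 * g\<^sup>2"
    using \<open>M\<^sup>2 \<le> d\<close> by (intro mult_nonneg_nonneg) (auto intro: order_trans [OF zero_le_power2])
  moreover have "\<kappa> * e\<^sub>0 \<le> e\<^sub>0 * e\<^sub>0"
    using \<kappa> e by (intro mult_right_mono) auto
  ultimately have nonneg: "0 \<le> e\<^sub>0\<^sup>2 - \<kappa> * e\<^sub>0 + d * L\<^sup>2 * g\<^sup>2"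
    by (simp add: power2_eq_square)
  have "\<beta>\<^sub>m\<^sub>i\<^sub>n = sqrt ((e\<^sub>0\<^sup>2 - \<kappa> * e\<^sub>0 + d * L\<^sup>2 * g\<^sup>2) / e\<^sub>0\<^sup>2)"
    unfolding assms(18) \<kappa>_def using e
    by (simp add: M_def g_def c_def field_simps power2_eq_square)
  with nonneg have \<beta>min: "0 \<le> \<beta>\<^sub>m\<^sub>i\<^sub>n" "\<beta>\<^sub>m\<^sub>i\<^sub>n\<^sup>2 * e\<^sub>0\<^sup>2 = e\<^sub>0\<^sup>2 - \<kappa> * e\<^sub>0 + d * L\<^sup>2 * g\<^sup>2"
    using e by simp_all
  then have \<beta>: "0 \<le> \<beta>" "\<beta> \<le> 1"
    using assms(19,20) by auto

  \<comment> \<open>Sharpness applies only strictly inside radius \<open>\<rho>\<close>. As \<open>e\<^sub>0 = \<rho>\<close> is possible, this follows from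
      the distance bound only after the first cycle, where \<open>\<beta> < 1\<close> makes it strict.\<close>
  have "X k \<in> Stiefel \<and> infdist (X k) \<X> < \<rho> \<and> infdist (X k) \<X> \<le> \<beta> ^ k * e\<^sub>0" for k
  proof (induction k)
    case 0
    then show ?case
      using X0 \<delta>0 e by (simp add: \<delta>0_def)
  next
    case (Suc k)
    have \<gamma>: "\<gamma> k = \<beta> ^ k * g"
      using assms(15) [of k] by (simp add: g_def)
    have B: "0 \<le> \<beta> ^ k" "\<beta> ^ k \<le> 1"
      using \<beta> by (auto intro: power_le_one)
    have "M * (\<gamma> k * c) \<le> \<beta> ^ k * 1"
      using small0 B(1) mult_left_mono [OF small0 B(1)] by (simp add: \<gamma> mult_ac)
    then have small: "real m * (\<gamma> k * (L + \<tau>)) \<le> 1"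
      using B(2) by (simp add: M_def c_def)
    have St: "Z k 0 \<in> Stiefel" and near: "infdist (Z k 0) \<X> < \<rho>"
      using Suc by (simp_all add: Z0)
    have "(infdist (Z k m) \<X>)\<^sup>2 \<le> (1 + 2 * M * (\<beta> ^ k * g) * c) * (infdist (X k) \<X>)\<^sup>2
      - 2 * M * (\<beta> ^ k * g) * \<alpha> * infdist (X k) \<X> + d * L\<^sup>2 * (\<beta> ^ k * g)\<^sup>2"
      using riem_incremental_distance_recursion
        [OF assms(5,7,9,1,8,2) \<gamma>pos small assms(10) St near Z]
      unfolding Z0 by (simp only: M_def c_def \<gamma> assms(13))
    then have "(infdist (Z k m) \<X>)\<^sup>2 \<le> (\<beta> ^ k)\<^sup>2 * (e\<^sub>0\<^sup>2 - \<kappa> * e\<^sub>0 + d * L\<^sup>2 * g\<^sup>2)"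
      using B pos \<kappa> Suc
      by (intro geometric_contraction [of "\<beta> ^ k" c M g "infdist (X k) \<X>" e\<^sub>0 \<kappa> \<alpha>])
         (auto simp: \<kappa>_def infdist_nonneg)
    also have "\<dots> = (\<beta> ^ k)\<^sup>2 * (\<beta>\<^sub>m\<^sub>i\<^sub>n\<^sup>2 * e\<^sub>0\<^sup>2)"
      by (simp only: \<beta>min)
    also have "\<dots> \<le> (\<beta> ^ k)\<^sup>2 * (\<beta>\<^sup>2 * e\<^sub>0\<^sup>2)"
      using \<beta>min(1) assms(19) by (intro mult_left_mono mult_right_mono power_mono) auto
    also have "\<dots> = (\<beta> ^ Suc k * e\<^sub>0)\<^sup>2"
      by (simp add: power_mult_distrib mult_ac)
    finally have le: "infdist (X (Suc k)) \<X> \<le> \<beta> ^ Suc k * e\<^sub>0"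
      unfolding Zm
    proof (rule power2_le_imp_le)
      show "0 \<le> \<beta> ^ Suc k * e\<^sub>0"
        using \<beta>(1) e(1) by (intro mult_nonneg_nonneg zero_le_power) auto
    qed
    have "\<beta> ^ Suc k \<le> \<beta>"
      using \<beta> B by (simp add: mult_left_le)
    then have "\<beta> ^ Suc k < 1"
      using assms(20) by simp
    then have "\<beta> ^ Suc k * e\<^sub>0 < 1 * e\<^sub>0"
      using e(1) by (intro mult_strict_right_mono)
    then have "infdist (X (Suc k)) \<X> < \<rho>"
      using le e(4) by simp
    moreover have "X (Suc k) \<in> Stiefel"
      unfolding Zm
      by (rule riem_incremental_cycle(1) [OF assms(5,7,9,1,8,2) \<gamma>pos small St Z])
    ultimately show ?case
      using le by blast
  qed
  then show ?thesis
    by blast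
qed

end
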